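(* Let $q$ be a power of a prime $p$ and let $n$ be an odd positive integer with $\gcd(n,q)=1$. The multiplier $\mu_{-q}$ gives a splitting of $n$ over $\mathbb{F}_{q^2}$ if and only if $\mathrm{ord}_r(q)\not\equiv 2\pmod 4$ for every prime $r$ dividing $n$.
   Context: $\mathrm{ord}_r(q)$ is the smallest positive integer $t$ with $q^t\equiv1\pmod r$. The $q^2$-cyclotomic coset of $s$ modulo $n$ is $\{s(q^2)^j\bmod n:j\ge0\}$. For $\gcd(b,n)=1$, $\mu_b$ gives a splitting of $n$ over $\mathbb{F}_{q^2}$ if there are sets $S_1,S_2$, each a union of $q^2$-cyclotomic cosets modulo $n$, with $S_1\cup S_2=\{1,\dots,n-1\}$, $S_1\cap S_2=\emptyset$, $bS_1\equiv S_2$ and $bS_2\equiv S_1\pmod n$. *)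

theory Defs
  imports "HOL-Number_Theory.Number_Theory"
begin

text \<open>
  Residues modulo \<open>n\<close> are represented by the integers \<open>0, \<dots>, n - 1\<close>. In the definitions below
  \<open>Q\<close> is the order of the underlying finite field. Negative multipliers such as \<open>-q\<close>
  are the reason for working with \<^typ>\<open>int\<close>.
\<close>

definition cyclotomic_coset :: "nat \<Rightarrow> nat \<Rightarrow> int \<Rightarrow> int set" where
  "cyclotomic_coset Q n s = {s * int Q ^ j mod int n | j. True}"

definition union_of_cyclotomic_cosets :: "nat \<Rightarrow> nat \<Rightarrow> int set \<Rightarrow> bool" where
  "union_of_cyclotomic_cosets Q n S \<longleftrightarrow> (\<exists>T. S = (\<Union>s\<in>T. cyclotomic_coset Q n s))"

definition multiplier :: "nat \<Rightarrow> int \<Rightarrow> int \<Rightarrow> int" where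
  "multiplier n b s = b * s mod int n"

text \<open>
  The sets \<open>S1\<close> and \<open>S2\<close> are allowed to be empty, which for \<open>n \<ge> 1\<close> happens exactly when \<open>n = 1\<close>.
\<close>

definition gives_splitting :: "nat \<Rightarrow> nat \<Rightarrow> int \<Rightarrow> bool" where
  "gives_splitting Q n b \<longleftrightarrow>
     coprime b (int n) \<and>
     (\<exists>S1 S2. union_of_cyclotomic_cosets Q n S1 \<and>
        union_of_cyclotomic_cosets Q n S2 \<and>
        S1 \<union> S2 = {1..int n - 1} \<and>
        S1 \<inter> S2 = {} \<and>
        multiplier n b ` S1 = S2 \<and>
        multiplier n b ` S2 = S1)"

end

theory Submission
  imports Defs
begin

text \<open>
  Since the square of \<open>\<mu>\<^bsub>-q\<^esub>\<close> is \<open>\<mu>\<close> with multiplier \<open>q\<^sup>2\<close>, which fixes every coset, \<open>\<mu>\<^bsub>-q\<^esub>\<close> acts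
  on the cosets as an involution. A splitting therefore exists iff no nonzero coset is fixed. A fixed
  coset of \<open>s\<close> means \<open>q ^ e \<equiv> -1\<close> modulo \<open>n / gcd s n > 1\<close> with \<open>e\<close> odd; this may be tested at the
  prime divisors \<open>r\<close> of \<open>n\<close>, where it says that the order of \<open>q\<close> is twice an odd number.
\<close>

section \<open>Cyclotomic cosets as a partition of the residues\<close>

lemma cyclotomic_coset_self:
  assumes "0 \<le> s" "s < int n"
  shows "s \<in> cyclotomic_coset Q n s"
  unfolding cyclotomic_coset_def using assms by (auto intro!: exI[of _ 0])

lemma cyclotomic_coset_trans:
  assumes "t \<in> cyclotomic_coset Q n s" "u \<in> cyclotomic_coset Q n t"
  shows "u \<in> cyclotomic_coset Q n s"
proof -
  obtain i j where "t = s * int Q ^ i mod int n" "u = t * int Q ^ j mod int n"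
    using assms unfolding cyclotomic_coset_def by auto
  then have "u = s * int Q ^ (i + j) mod int n"
    by (simp add: mod_mult_left_eq power_add mult.assoc)
  then show ?thesis
    unfolding cyclotomic_coset_def by blast
qed

text \<open>Coprimality makes \<open>Q\<close> a unit of finite order modulo \<open>n\<close>, so
  further multiplications by \<open>Q\<close> lead from \<open>t\<close> back to \<open>s\<close>.
  Hence distinct cosets of residues are disjoint.\<close>

lemma cyclotomic_coset_eq:
  assumes "coprime Q n" "t \<in> cyclotomic_coset Q n s"
  shows "cyclotomic_coset Q n t = cyclotomic_coset Q n s"
proof
  show "cyclotomic_coset Q n t \<subseteq> cyclotomic_coset Q n s"
    using assms cyclotomic_coset_trans by blast
  obtain i where i: "t = s * int Q ^ i mod int n"
    using assms unfolding cyclotomic_coset_def by auto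
  show "cyclotomic_coset Q n s \<subseteq> cyclotomic_coset Q n t"
  proof
    fix u assume "u \<in> cyclotomic_coset Q n s"
    then obtain j where j: "u = s * int Q ^ j mod int n"
      unfolding cyclotomic_coset_def by auto
    \<comment> \<open>The natural exponent would be \<open>j - i\<close>, which may be negative;
      adding \<open>i\<close> full periods gives this \<open>k\<close>. The truncated subtraction is
      exact because the order is positive.\<close>
    define k where "k = j + i * (ord n Q - 1)"
    have "ord n Q > 0"
      using assms by (simp add: coprime_commute)
    then have exponent: "i + k = j + ord n Q * i"
      unfolding k_def by (cases "ord n Q") auto
    have "[Q ^ (ord n Q * i) = 1] (mod n)"
      using ord_works[of Q n] cong_pow[of "Q ^ ord n Q" 1 n i] by (simp add: power_mult)
    then have one: "[int Q ^ (ord n Q * i) = 1] (mod int n)"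
      by (metis cong_int_iff of_nat_1 of_nat_power)
    have "t * int Q ^ k mod int n = s * int Q ^ (i + k) mod int n"
      by (simp add: i mod_mult_left_eq power_add mult.assoc)
    also have "\<dots> = (s * int Q ^ j) * int Q ^ (ord n Q * i) mod int n"
      by (simp add: exponent power_add mult.assoc)
    also have "\<dots> = u"
      using cong_scalar_left[OF one, of "s * int Q ^ j"] j by (simp add: cong_def)
    finally show "u \<in> cyclotomic_coset Q n t"
      unfolding cyclotomic_coset_def by blast
  qed
qed

text \<open>Multiplication by \<open>b\<close> commutes with multiplication by \<open>Q\<close>, so
  the multiplier acts on cosets as a whole.\<close>

lemma cyclotomic_coset_multiplier:
  "cyclotomic_coset Q n (multiplier n b s) = multiplier n b ` cyclotomic_coset Q n s"
proof -
  have "multiplier n b s * int Q ^ j mod int n = multiplier n b (s * int Q ^ j mod int n)" for j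
    by (simp add: multiplier_def mod_mult_left_eq mod_mult_right_eq mult.assoc)
  then show ?thesis
    unfolding cyclotomic_coset_def by auto
qed

lemma union_of_cyclotomic_cosets_closed:
  assumes "union_of_cyclotomic_cosets Q n S" "s \<in> S"
  shows "cyclotomic_coset Q n s \<subseteq> S"
  using assms cyclotomic_coset_trans unfolding union_of_cyclotomic_cosets_def by blast

lemma union_of_cyclotomic_cosetsI:
  assumes "S \<subseteq> {0..int n - 1}" "\<And>s. s \<in> S \<Longrightarrow> cyclotomic_coset Q n s \<subseteq> S"
  shows "union_of_cyclotomic_cosets Q n S"
  unfolding union_of_cyclotomic_cosets_def
\<comment> \<open>\<open>S\<close> indexes its own cosets; its elements are reduced residues, so
  each lies in its own coset.\<close>
proof (intro exI[of _ S] equalityI subsetI)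
  fix s assume "s \<in> S"
  moreover from this have "s \<in> cyclotomic_coset Q n s"
    using assms(1) by (intro cyclotomic_coset_self) auto
  ultimately show "s \<in> (\<Union>s\<in>S. cyclotomic_coset Q n s)" by blast
qed (use assms(2) in blast)

section \<open>Multipliers on nonzero residues and the splitting criterion\<close>

lemma mult_mod_nonzero:
  assumes "coprime b (int n)" "s \<in> {1..int n - 1}"
  shows "b * s mod int n \<in> {1..int n - 1}"
proof -
  have "\<not> int n dvd b * s"
    using assms by (auto simp: coprime_dvd_mult_right_iff coprime_commute dest: zdvd_imp_le)
  moreover have "0 \<le> b * s mod int n" "b * s mod int n < int n"
    using assms(2) by auto
  ultimately show ?thesis
    by (simp add: dvd_eq_mod_eq_0)
qed

lemma cyclotomic_coset_nonzero:
  assumes "coprime Q n" "s \<in> {1..int n - 1}"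
  shows "cyclotomic_coset Q n s \<subseteq> {1..int n - 1}"
proof -
  have "int Q ^ j * s mod int n \<in> {1..int n - 1}" for j
    using assms by (intro mult_mod_nonzero) auto
  then show ?thesis
    unfolding cyclotomic_coset_def by (auto simp: mult.commute)
qed

lemma multiplier_permutes_nonzero:
  assumes "coprime b (int n)"
  shows "multiplier n b ` {1..int n - 1} = {1..int n - 1}"
proof (intro endo_inj_surj inj_onI)
  show "multiplier n b ` {1..int n - 1} \<subseteq> {1..int n - 1}"
    using mult_mod_nonzero[OF assms] unfolding multiplier_def by blast
next
  fix s t assume st: "s \<in> {1..int n - 1}" "t \<in> {1..int n - 1}"
    and "multiplier n b s = multiplier n b t"
  then have "[s = t] (mod int n)"
    using assms by (simp add: multiplier_def cong_mult_lcancel flip: cong_def)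
  with st show "s = t"
    by (auto simp: cong_def)
qed simp

text \<open>A fixed coset meeting \<open>S1\<close> or \<open>S2\<close> would meet both. Without
  fixed cosets, the involution groups the nonzero cosets into pairs, and a splitting arises by
  putting one member of each pair into \<open>S1\<close>.\<close>

lemma gives_splitting_iff_no_fixed_coset:
  assumes "coprime Q n" "coprime b (int n)" and square: "[b\<^sup>2 = int Q] (mod int n)"
  shows "gives_splitting Q n b \<longleftrightarrow>
    (\<forall>s\<in>{1..int n - 1}. multiplier n b s \<notin> cyclotomic_coset Q n s)"
proof
  assume "gives_splitting Q n b"
  then obtain S1 S2 where S:
    "union_of_cyclotomic_cosets Q n S1" "union_of_cyclotomic_cosets Q n S2"
    "S1 \<union> S2 = {1..int n - 1}" "S1 \<inter> S2 = {}"
    "multiplier n b ` S1 = S2" "multiplier n b ` S2 = S1"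
    unfolding gives_splitting_def by metis
  show "\<forall>s\<in>{1..int n - 1}. multiplier n b s \<notin> cyclotomic_coset Q n s"
  proof
    fix s assume "s \<in> {1..int n - 1}"
    then consider "s \<in> S1" | "s \<in> S2" using S(3) by blast
    then show "multiplier n b s \<notin> cyclotomic_coset Q n s"
    proof cases
      case 1
      then have "multiplier n b s \<in> S2" using S(5) by auto
      then show ?thesis
        using S(4) union_of_cyclotomic_cosets_closed[OF S(1) 1] by auto
    next
      case 2
      then have "multiplier n b s \<in> S1" using S(6) by auto
      then show ?thesis
        using S(4) union_of_cyclotomic_cosets_closed[OF S(2) 2] by auto
    qed
  qed
next
  let ?C = "cyclotomic_coset Q n" and ?f = "multiplier n b" and ?X = "{1..int n - 1}"
  assume no_fixed: "\<forall>s\<in>?X. ?f s \<notin> ?C s"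
  have f_X: "?f s \<in> ?X" if "s \<in> ?X" for s
    using multiplier_permutes_nonzero[OF assms(2)] that by blast
  have C_neq: "?C (?f s) \<noteq> ?C s" if "s \<in> ?X" for s
    using no_fixed that f_X[OF that] cyclotomic_coset_self[of "?f s" n Q] by auto
  have "?f (?f s) = s * int Q ^ 1 mod int n" for s
    using cong_scalar_right[OF square, of s]
    by (simp add: multiplier_def cong_def mod_mult_right_eq power2_eq_square mult.assoc
        mult.commute[of s])
  then have "?f (?f s) \<in> ?C s" for s
    unfolding cyclotomic_coset_def by blast
  then have C_ff: "?C (?f (?f s)) = ?C s" for s
    using cyclotomic_coset_eq[OF assms(1)] by blast
  \<comment> \<open>The choice depends only on the unordered pair of cosets, so \<open>s\<close> and
    \<open>?f s\<close> receive the same chosen coset.\<close>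
  define c where "c s = (SOME A. A \<in> {?C s, ?C (?f s)})" for s
  have c_in: "c s \<in> {?C s, ?C (?f s)}" for s
    unfolding c_def by (rule someI_ex) blast
  have c_f: "c (?f s) = c s" for s
    unfolding c_def C_ff by (simp add: insert_commute)
  have c_coset: "?C t = ?C s \<and> c t = c s" if "t \<in> ?C s" for s t
    using cyclotomic_coset_eq[OF assms(1) that]
    unfolding c_def cyclotomic_coset_multiplier by simp
  define S1 where "S1 = {s \<in> ?X. ?C s = c s}"
  define S2 where "S2 = {s \<in> ?X. ?C s \<noteq> c s}"
  have unions: "union_of_cyclotomic_cosets Q n S1" "union_of_cyclotomic_cosets Q n S2"
  proof -
    have "?C s \<subseteq> S1" if "s \<in> S1" for s
      using that cyclotomic_coset_nonzero[OF assms(1), of s] c_coset[of _ s]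
      unfolding S1_def by blast
    then show "union_of_cyclotomic_cosets Q n S1"
      by (intro union_of_cyclotomic_cosetsI) (auto simp: S1_def)
    have "?C s \<subseteq> S2" if "s \<in> S2" for s
      using that cyclotomic_coset_nonzero[OF assms(1), of s] c_coset[of _ s]
      unfolding S2_def by blast
    then show "union_of_cyclotomic_cosets Q n S2"
      by (intro union_of_cyclotomic_cosetsI) (auto simp: S2_def)
  qed
  have partition: "S1 \<union> S2 = ?X" "S1 \<inter> S2 = {}"
    unfolding S1_def S2_def by auto
  have "?f ` S1 \<subseteq> S2"
    using f_X C_neq unfolding S1_def S2_def by (simp add: image_subset_iff c_f) metis
  moreover have "?f ` S2 \<subseteq> S1"
  proof
    fix t assume "t \<in> ?f ` S2"
    then obtain s where "t = ?f s" "s \<in> ?X" "?C s \<noteq> c s"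
      unfolding S2_def by blast
    then show "t \<in> S1"
      using c_in[of s] f_X[of s] unfolding S1_def by (simp add: c_f)
  qed
  \<comment> \<open>Surjectivity on the nonzero residues turns the two inclusions into
    equalities.\<close>
  moreover have "?f ` S1 \<union> ?f ` S2 = S1 \<union> S2"
    using multiplier_permutes_nonzero[OF assms(2)] partition by (simp flip: image_Un)
  ultimately have "?f ` S1 = S2 \<and> ?f ` S2 = S1"
    using partition(2) by (simp only: set_eq_iff subset_iff Un_iff Int_iff empty_iff) metis
  with unions partition show "gives_splitting Q n b"
    unfolding gives_splitting_def using assms(2) by metis
qed

section \<open>Orders that are twice an odd number\<close>

text \<open>If the order is \<open>2 * e\<close> with \<open>e\<close> odd, then
  \<open>q ^ e\<close> is a square root of 1 modulo the prime \<open>r\<close> other than 1, hence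
  -1. Conversely, -1 as an odd power \<open>q ^ e\<close> forces the order to divide
  \<open>2 * e\<close> but not \<open>e\<close>.\<close>

lemma ord_cong_2_mod_4_iff:
  fixes q r :: nat
  assumes "prime r" "odd r"
  shows "[ord r q = 2] (mod 4) \<longleftrightarrow> (\<exists>e. odd e \<and> [int q ^ e = -1] (mod int r))"
proof
  assume "[ord r q = 2] (mod 4)"
  then have "ord r q mod 4 = 2" by (simp add: cong_def)
  then have "ord r q = 2 * (ord r q div 2)" "odd (ord r q div 2)" by presburger+
  then obtain e where e: "ord r q = 2 * e" "odd e" by blast
  have "[q ^ (2 * e) = 1] (mod r)"
    using ord_works[of q r] e(1) by simp
  then have "[int q ^ (2 * e) = 1] (mod int r)"
    by (metis cong_int_iff of_nat_1 of_nat_power)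
  then have "int r dvd (int q ^ e - 1) * (int q ^ e + 1)"
    by (simp add: cong_iff_dvd_diff algebra_simps flip: power_add mult_2)
  then have "int r dvd int q ^ e - 1 \<or> int r dvd int q ^ e + 1"
    using assms(1) by (simp add: prime_dvd_mult_iff)
  moreover have "\<not> int r dvd int q ^ e - 1"
  proof
    assume "int r dvd int q ^ e - 1"
    then have "[q ^ e = 1] (mod r)"
      by (metis cong_iff_dvd_diff cong_int_iff of_nat_1 of_nat_power)
    then have "ord r q dvd e" by (simp only: ord_divides)
    with e show False by (auto dest!: dvd_imp_le elim: oddE)
  qed
  ultimately show "\<exists>e. odd e \<and> [int q ^ e = -1] (mod int r)"
    using e(2) by (auto simp: cong_iff_dvd_diff)
next
  assume "\<exists>e. odd e \<and> [int q ^ e = -1] (mod int r)"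
  then obtain e where e: "odd e" "[int q ^ e = -1] (mod int r)" by blast
  \<comment> \<open>Oddness of \<open>r\<close> is what separates 1 from -1.\<close>
  have "r \<noteq> 2" using assms(2) by auto
  with prime_ge_2_nat[OF assms(1)] have r2: "r > 2" by simp
  have not_dvd: "\<not> ord r q dvd e"
  proof
    assume "ord r q dvd e"
    then have "[q ^ e = 1] (mod r)" by (simp only: ord_divides)
    then have "[int q ^ e = 1] (mod int r)"
      by (metis cong_int_iff of_nat_1 of_nat_power)
    with e(2) have "[1 = -1] (mod int r)"
      using cong_sym cong_trans by blast
    then have "int r dvd 2" by (simp add: cong_iff_dvd_diff)
    with r2 show False by (auto dest: zdvd_imp_le)
  qed
  have "[int q ^ (e * 2) = (-1)\<^sup>2] (mod int r)"
    unfolding power_mult using e(2) by (rule cong_pow)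
  then have "[int (q ^ (2 * e)) = int 1] (mod int r)"
    by (simp add: mult.commute)
  then have dvd: "ord r q dvd 2 * e"
    unfolding cong_int_iff by (simp only: ord_divides)
  \<comment> \<open>An odd order would be coprime to 2 and so divide \<open>e\<close>.\<close>
  with not_dvd have "even (ord r q)"
    using coprime_dvd_mult_right_iff[of "ord r q" 2 e] by auto
  then obtain d where d: "ord r q = 2 * d" by blast
  with dvd e(1) have "odd d" by auto
  with d show "[ord r q = 2] (mod 4)"
    unfolding cong_def by presburger
qed

section \<open>Fixed cosets and reduction to prime divisors\<close>

theorem theorem5p1:
  fixes p q k n :: nat
  assumes "prime p"
    and "k \<ge> 1"
    and "q = p ^ k"
    and "n > 0"
    and "odd n"
    and "coprime n q"
  shows "gives_splitting (q ^ 2) n (- int q) \<longleftrightarrow>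
    (\<forall>r. prime r \<and> r dvd n \<longrightarrow> \<not> [ord r q = 2] (mod 4))"
proof -
  have coprime_qn: "coprime (int n) (int q)"
    using assms(6) by simp
  \<comment> \<open>Membership means that \<open>n\<close> divides
    \<open>s * (q ^ (2 * j) + q)\<close> for some \<open>j\<close>; cancelling the unit
    \<open>q\<close> leaves the odd exponent \<open>2 * j - 1\<close>.\<close>
  have fixed_iff: "multiplier n (- int q) s \<in> cyclotomic_coset (q ^ 2) n s \<longleftrightarrow>
      (\<exists>e. odd e \<and> int n dvd s * (int q ^ e + 1))" for s
  proof -
    have "multiplier n (- int q) s = s * int (q ^ 2) ^ j mod int n \<longleftrightarrow>
        int n dvd s * (int q ^ (2 * j) + int q)" for j
    proof -
      have "s * int (q ^ 2) ^ j - - int q * s = s * (int q ^ (2 * j) + int q)"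
        by (simp add: algebra_simps flip: power_mult)
      moreover have "multiplier n (- int q) s = s * int (q ^ 2) ^ j mod int n \<longleftrightarrow>
          [s * int (q ^ 2) ^ j = - int q * s] (mod int n)"
        unfolding multiplier_def cong_def by (rule eq_commute)
      ultimately show ?thesis
        by (simp only: cong_iff_dvd_diff)
    qed
    then have "multiplier n (- int q) s \<in> cyclotomic_coset (q ^ 2) n s \<longleftrightarrow>
        (\<exists>j. int n dvd s * (int q ^ (2 * j) + int q))"
      unfolding cyclotomic_coset_def by auto
    also have "\<dots> \<longleftrightarrow> (\<exists>e. odd e \<and> int n dvd s * (int q ^ e + 1))"
    proof
      assume "\<exists>j. int n dvd s * (int q ^ (2 * j) + int q)"
      then obtain j where j: "int n dvd s * (int q ^ (2 * j) + int q)" by blast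
      show "\<exists>e. odd e \<and> int n dvd s * (int q ^ e + 1)"
      proof (cases j)
        case 0
        \<comment> \<open>Here \<open>2 * j - 1\<close> would be negative, but the factor is already
          \<open>1 + q\<close>, so \<open>e = 1\<close> works.\<close>
        with j show ?thesis by (intro exI[of _ 1]) (simp add: add.commute)
      next
        case (Suc i)
        have "s * (int q ^ (2 * j) + int q) = int q * (s * (int q ^ (2 * i + 1) + 1))"
          by (simp add: Suc algebra_simps)
        with j have "int n dvd s * (int q ^ (2 * i + 1) + 1)"
          using coprime_qn by (simp only: coprime_dvd_mult_right_iff)
        then show ?thesis by (intro exI[of _ "2 * i + 1"]) simp
      qed
    next
      assume "\<exists>e. odd e \<and> int n dvd s * (int q ^ e + 1)"
      then obtain i where "int n dvd s * (int q ^ (2 * i + 1) + 1)"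
        by (auto elim!: oddE)
      then have "int n dvd int q * (s * (int q ^ (2 * i + 1) + 1))"
        by (rule dvd_mult)
      also have "\<dots> = s * (int q ^ (2 * (i + 1)) + int q)"
        by (simp add: algebra_simps)
      finally show "\<exists>j. int n dvd s * (int q ^ (2 * j) + int q)" by blast
    qed
    finally show ?thesis .
  qed
  have "gives_splitting (q ^ 2) n (- int q) \<longleftrightarrow>
      \<not> (\<exists>s\<in>{1..int n - 1}. \<exists>e. odd e \<and> int n dvd s * (int q ^ e + 1))"
    using gives_splitting_iff_no_fixed_coset[of "q ^ 2" n "- int q"] assms(6) fixed_iff
    by (simp add: coprime_commute)
  also have "(\<exists>s\<in>{1..int n - 1}. \<exists>e. odd e \<and> int n dvd s * (int q ^ e + 1)) \<longleftrightarrow>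
      (\<exists>r e. prime r \<and> r dvd n \<and> odd e \<and> [int q ^ e = -1] (mod int r))"
  proof
    assume "\<exists>s\<in>{1..int n - 1}. \<exists>e. odd e \<and> int n dvd s * (int q ^ e + 1)"
    then obtain s e where s: "s \<in> {1..int n - 1}" "odd e" "int n dvd s * (int q ^ e + 1)"
      by blast
    \<comment> \<open>Were \<open>n\<close> coprime to \<open>q ^ e + 1\<close>, it would divide
      \<open>s\<close>; hence the two share a prime factor.\<close>
    have "\<not> int n dvd s"
      using s(1) by (auto dest: zdvd_imp_le)
    with s(3) have "\<not> coprime (int n) (int (q ^ e + 1))"
      by (auto simp: coprime_dvd_mult_left_iff add.commute)
    then have "\<not> coprime n (q ^ e + 1)"
      unfolding coprime_int_iff .
    then have "gcd n (q ^ e + 1) \<noteq> 1"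
      unfolding coprime_iff_gcd_eq_1 .
    from prime_factor_nat[OF this] obtain r where r: "prime r" "r dvd n" "r dvd q ^ e + 1"
      by auto
    then have "int r dvd int (q ^ e + 1)"
      by (simp only: int_dvd_int_iff)
    then have "[int q ^ e = -1] (mod int r)"
      by (simp add: cong_iff_dvd_diff add.commute)
    with r s(2) show "\<exists>r e. prime r \<and> r dvd n \<and> odd e \<and> [int q ^ e = -1] (mod int r)"
      by blast
  next
    assume "\<exists>r e. prime r \<and> r dvd n \<and> odd e \<and> [int q ^ e = -1] (mod int r)"
    then obtain r e m where r: "prime r" "n = r * m" "odd e" "int r dvd int q ^ e + 1"
      by (auto simp: cong_iff_dvd_diff elim!: dvdE[of _ n])
    \<comment> \<open>The residue with a fixed coset is \<open>m\<close>, the quotient of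
      \<open>n\<close> by \<open>r\<close>: the missing factor \<open>r\<close> is supplied by
      \<open>q ^ e + 1\<close>.\<close>
    have "m > 0" "m < n"
      using r(1,2) assms(4) prime_gt_1_nat[OF r(1)] by auto
    moreover have "int n dvd int m * (int q ^ e + 1)"
      using r(2,4) by (simp add: mult.commute mult_dvd_mono)
    ultimately show "\<exists>s\<in>{1..int n - 1}. \<exists>e. odd e \<and> int n dvd s * (int q ^ e + 1)"
      using r(3) by (intro bexI[of _ "int m"]) auto
  qed
  finally show ?thesis
    \<comment> \<open>Since \<open>n\<close> is odd, so is each prime divisor, as the order
      criterion requires.\<close>
    using ord_cong_2_mod_4_iff[of _ q] dvd_trans[of 2 _ n] assms(5) by blast
qed

end
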